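(* FullGreedy cannot achieve an approximation ratio better than $1/2$ for the $d$-HAG problem: for $d=2$ and $k=3$ there exist a finite directed graph $G$ and an execution of FullGreedy (i.e. a choice of maximizers in its argmax steps) on the GNN computation graph of $G$ whose output $\hat{\mathcal G}_{greedy}$ satisfies $\mathrm{value}(\hat{\mathcal G}_{greedy})=1$, while the maximum of $\mathrm{value}(\hat{\mathcal G})$ over all $2$-HAG computation graphs $\hat{\mathcal G}$ for $G$ with at most $3$ intermediate nodes equals $2$.
   Context: GNN computation graph. For a finite directed graph $G=(V,E)$, $\mathcal G=(L,R,\mathcal E)$ is the bipartite directed graph where $L,R$ are two disjoint copies of $V$ and $(u_L,v_R)\in\mathcal E$ iff $(u,v)\in E$. HAG computation graph for $G$: a directed acyclic graph $\hat{\mathcal G}=(L\cup M\cup R,\hat{\mathcal E})$, $M$ a finite set of intermediate nodes, with edges only from $L$ to $M$, from $M$ to $R$, within $M$, and directly from $L$ to $R$, such that for $u,v\in V$ there is exactly one directed path from $u_L$ to $v_R$ if $(u,v)\in E$, and none otherwise. It is a $d$-HAG computation graph if every $m\in M$ has in-degree exactly $d$. For a vertex $v$, $\mathrm{cover}(v)$ is the set of $w\in L$ with a directed path from $w$ to $v$; distinct $m\in M$ are assumed to have distinct covers. Value. For a computation graph with vertex set $\mathcal V$ and right-hand side $R$, $\mathrm{cost}=c_{Agg}\sum_{w\in\mathcal V}(\mathrm{indeg}(w)-1)+c_{Up}|R|$ with positive constants $c_{Agg},c_{Up}$; and $\mathrm{value}(\hat{\mathcal G})=\frac1{c_{Agg}}(\mathrm{cost}(\mathcal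 G)-\mathrm{cost}(\hat{\mathcal G}))$. $d$-HAG problem: given $G$ and $k$, find a $d$-HAG computation graph for $G$ with $|M|\le k$ of largest value. FullGreedy, input $\mathcal G,k,d$. Start with $\hat{\mathcal G}_0=\mathcal G$, $M_0=\emptyset$. For $i=1,\dots,k$: choose $C\subseteq L\cup M_{i-1}$ with $|C|=d$ maximizing $|R_C|$, where $R_C=R\cap\bigcap_{v\in C}\hat\Gamma_{out}(v)$ and $\hat\Gamma_{out}$ is the out-neighborhood in $\hat{\mathcal G}_{i-1}$; add a new node $v_i$ to get $M_i=M_{i-1}\cup\{v_i\}$; add edges $(\ell,v_i)$ for $\ell\in C$ and $(v_i,r)$ for $r\in R_C$; remove all edges $(\ell,r)$ with $\ell\in C$, $r\in R_C$; the result is $\hat{\mathcal G}_i$. Return $\hat{\mathcal G}_k$. *)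

theory Defs
  imports Complex_Main "Graph_Theory.Graph_Theory"
begin

text \<open>
  Nodes of computation graphs over a vertex type: \<open>Lft v\<close> and \<open>Rgt v\<close> are the two copies
  of a vertex \<open>v\<close>; intermediate nodes carry natural numbers as names, which is no restriction
  because every computation graph has only finitely many of them.
\<close>

datatype 'a node = Lft 'a | Mid nat | Rgt 'a

type_synonym 'a cgraph = "'a node pair_pre_digraph"

definition left_nodes :: "'a cgraph \<Rightarrow> 'a node set" where
  "left_nodes H = pverts H \<inter> range Lft"

definition mid_nodes :: "'a cgraph \<Rightarrow> 'a node set" where
  "mid_nodes H = pverts H \<inter> range Mid"

definition right_nodes :: "'a cgraph \<Rightarrow> 'a node set" where
  "right_nodes H = pverts H \<inter> range Rgt"

definition gnn_graph :: "'a pair_pre_digraph \<Rightarrow> 'a cgraph" where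
  "gnn_graph G =
     \<lparr> pverts = Lft ` pverts G \<union> Rgt ` pverts G,
       parcs = {(Lft u, Rgt v) | u v. (u, v) \<in> parcs G} \<rparr>"

text \<open>The set of left-hand nodes from which \<open>v\<close> can be reached by a directed path.\<close>

definition cover :: "'a cgraph \<Rightarrow> 'a node \<Rightarrow> 'a node set" where
  "cover H v = {w \<in> left_nodes H. w \<rightarrow>\<^sup>*\<^bsub>with_proj H\<^esub> v}"

definition hag_graph :: "'a pair_pre_digraph \<Rightarrow> 'a cgraph \<Rightarrow> bool" where
  "hag_graph G H \<longleftrightarrow>
     left_nodes H = Lft ` pverts G \<and>
     right_nodes H = Rgt ` pverts G \<and>
     finite (mid_nodes H) \<and>
     parcs H \<subseteq> left_nodes H \<times> mid_nodes H \<union> mid_nodes H \<times> right_nodes H \<union>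
               mid_nodes H \<times> mid_nodes H \<union> left_nodes H \<times> right_nodes H \<and>
     acyclic (parcs H) \<and>
     (\<forall>u \<in> pverts G. \<forall>v \<in> pverts G.
        if (u, v) \<in> parcs G
        then \<exists>!p. pre_digraph.apath (with_proj H) (Lft u) p (Rgt v)
        else \<not> (\<exists>p. pre_digraph.apath (with_proj H) (Lft u) p (Rgt v))) \<and>
     inj_on (cover H) (mid_nodes H)"

definition d_hag_graph :: "nat \<Rightarrow> 'a pair_pre_digraph \<Rightarrow> 'a cgraph \<Rightarrow> bool" where
  "d_hag_graph d G H \<longleftrightarrow>
     hag_graph G H \<and> (\<forall>m \<in> mid_nodes H. in_degree (with_proj H) m = d)"

definition cost :: "real \<Rightarrow> real \<Rightarrow> 'a cgraph \<Rightarrow> real" where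
  "cost cAgg cUp H =
     cAgg * (\<Sum>w \<in> pverts H. real (in_degree (with_proj H) w) - 1) +
     cUp * real (card (right_nodes H))"

definition hag_value :: "real \<Rightarrow> real \<Rightarrow> 'a pair_pre_digraph \<Rightarrow> 'a cgraph \<Rightarrow> real" where
  "hag_value cAgg cUp G H = (1 / cAgg) * (cost cAgg cUp (gnn_graph G) - cost cAgg cUp H)"

text \<open>Optimal solutions of the \<open>d\<close>-HAG problem with input \<open>G\<close> and \<open>k\<close>.\<close>

definition optimal_d_hag ::
    "real \<Rightarrow> real \<Rightarrow> nat \<Rightarrow> 'a pair_pre_digraph \<Rightarrow> nat \<Rightarrow> 'a cgraph \<Rightarrow> bool" where
  "optimal_d_hag cAgg cUp d G k =
     is_arg_max (hag_value cAgg cUp G) (\<lambda>H. d_hag_graph d G H \<and> card (mid_nodes H) \<le> k)"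

definition out_nbrs :: "'a cgraph \<Rightarrow> 'a node \<Rightarrow> 'a node set" where
  "out_nbrs H v = {w. (v, w) \<in> parcs H}"

definition common_right :: "'a cgraph \<Rightarrow> 'a node set \<Rightarrow> 'a node set" where
  "common_right H C = right_nodes H \<inter> (\<Inter>v \<in> C. out_nbrs H v)"

definition add_aggregation :: "'a cgraph \<Rightarrow> 'a node set \<Rightarrow> 'a node \<Rightarrow> 'a cgraph" where
  "add_aggregation H C m =
     (let RC = common_right H C in
      \<lparr> pverts = insert m (pverts H),
        parcs = (parcs H \<union> C \<times> {m} \<union> {m} \<times> RC) - C \<times> RC \<rparr>)"

text \<open>
  \<open>full_greedy_run d G i H\<close>: some choice of maximizers in the first \<open>i\<close> iterations of FullGreedy
  leads to the graph \<open>H\<close>.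
\<close>

inductive full_greedy_run :: "nat \<Rightarrow> 'a pair_pre_digraph \<Rightarrow> nat \<Rightarrow> 'a cgraph \<Rightarrow> bool"
  for d :: nat and G :: "'a pair_pre_digraph" where
  start: "full_greedy_run d G 0 (gnn_graph G)"
| step: "\<lbrakk> full_greedy_run d G i H;
           is_arg_max (\<lambda>C. card (common_right H C))
             (\<lambda>C. C \<subseteq> left_nodes H \<union> mid_nodes H \<and> card C = d) C \<rbrakk>
         \<Longrightarrow> full_greedy_run d G (Suc i) (add_aggregation H C (Mid (Suc i)))"

text \<open>
  Worst-case guarantee over all instances and all executions. Every finite digraph is isomorphic
  to one whose vertices are natural numbers, so no instances are lost.
\<close>

definition full_greedy_achieves_ratio :: "real \<Rightarrow> real \<Rightarrow> nat \<Rightarrow> real \<Rightarrow> bool" where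
  "full_greedy_achieves_ratio cAgg cUp d \<alpha> \<longleftrightarrow>
     (\<forall>(G :: nat pair_pre_digraph) k H Hopt.
        pair_fin_digraph G \<longrightarrow> full_greedy_run d G k H \<longrightarrow> optimal_d_hag cAgg cUp d G k Hopt \<longrightarrow>
        hag_value cAgg cUp G H \<ge> \<alpha> * hag_value cAgg cUp G Hopt)"

end

(*
The in-neighbourhoods of the vertices 0, 1, 2, 3 are {0,1,2}, {1,2,3}, {0,1} and {2,3}. FullGreedy
may start with {1,2}, which gains 1 and destroys both other pairs with two common successors, {0,1}
and {2,3}; every later step gains 0. Aggregating {0,1} and {2,3} instead gains 2.

This is optimal: in a HAG computation graph a right-hand node of in-degree 1 is fed by an
intermediate node that determines its in-neighbourhood in G (size at least 2 rules out a left-hand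
node). As the in-neighbourhoods are distinct, at most |M| right-hand nodes have in-degree 1, so
there are at least 2|V| - |M| arcs into R and 2|M| arcs into M. Hence the value is at most
|E| - 2|V| = 2, for any number of intermediate nodes.
*)

theory Submission
  imports Defs
begin

section \<open>Counting nodes and arcs: the value in terms of arcs\<close>

lemma pverts_eq: "pverts H = left_nodes H \<union> mid_nodes H \<union> right_nodes H"
proof -
  have "x \<in> range Lft \<union> range Mid \<union> range Rgt" for x :: "'a node"
    by (cases x) auto
  then show ?thesis
    by (auto simp: left_nodes_def mid_nodes_def right_nodes_def)
qed

lemma sum_in_degree:
  assumes "pair_fin_digraph H"
  shows "(\<Sum>w\<in>pverts H. in_degree (with_proj H) w) = card (parcs H)"
proof -
  interpret pair_fin_digraph H by fact
  have "(\<Sum>w\<in>pverts H. in_degree (with_proj H) w) = (\<Sum>w\<in>pverts H. \<Sum>e\<in>{e \<in> parcs H. snd e = w}. 1)"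
    by (simp add: in_degree_def in_arcs_def)
  also have "\<dots> = (\<Sum>e\<in>parcs H. 1)"
    using pair_finite_arcs pair_finite_verts in_arcsD2 by (intro sum.group) auto
  finally show ?thesis by simp
qed

lemma gnn_graph_fin_digraph:
  assumes "pair_fin_digraph G"
  shows "pair_fin_digraph (gnn_graph G)"
proof -
  interpret G: pair_fin_digraph G by fact
  have "parcs (gnn_graph G) = (\<lambda>(u, v). (Lft u, Rgt v)) ` parcs G"
    by (auto simp: gnn_graph_def)
  then show ?thesis
    using G.pair_finite_verts G.pair_finite_arcs G.in_arcsD1 G.in_arcsD2
    by unfold_locales (auto simp: gnn_graph_def)
qed

lemma nodes_gnn_graph:
  "left_nodes (gnn_graph G) = Lft ` pverts G"
  "mid_nodes (gnn_graph G) = {}"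
  "right_nodes (gnn_graph G) = Rgt ` pverts G"
  by (auto simp: gnn_graph_def left_nodes_def mid_nodes_def right_nodes_def)

lemma card_parcs_gnn_graph: "card (parcs (gnn_graph G)) = card (parcs G)"
proof -
  have "parcs (gnn_graph G) = (\<lambda>(u, v). (Lft u, Rgt v)) ` parcs G"
    by (auto simp: gnn_graph_def)
  then show ?thesis
    by (simp add: card_image inj_on_def split: prod.splits)
qed

lemma cost_eq:
  assumes "pair_fin_digraph H"
  shows "cost cAgg cUp H =
    cAgg * (real (card (parcs H)) - real (card (pverts H))) + cUp * real (card (right_nodes H))"
  unfolding cost_def sum_in_degree[OF assms, symmetric]
  by (simp add: sum_subtractf)

lemma card_pverts_eq:
  assumes "pair_fin_digraph G" "pair_fin_digraph H"
    and "left_nodes H = Lft ` pverts G" "right_nodes H = Rgt ` pverts G"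
  shows "card (pverts H) = 2 * card (pverts G) + card (mid_nodes H)"
proof -
  have "finite (pverts G)" "finite (pverts H)"
    using assms by (simp_all add: pair_fin_digraph.pair_finite_verts)
  then have "finite (mid_nodes H)" by (simp add: mid_nodes_def)
  moreover have "(Lft ` pverts G \<union> mid_nodes H) \<inter> Rgt ` pverts G = {}"
    "Lft ` pverts G \<inter> mid_nodes H = {}"
    by (auto simp: mid_nodes_def)
  ultimately show ?thesis
    using \<open>finite (pverts G)\<close> unfolding pverts_eq[of H] assms(3,4)
    by (simp add: card_Un_disjoint card_image inj_on_def)
qed

text \<open>Summing \<open>in_degree w - 1\<close> over all nodes gives arcs minus nodes. The two
  graphs share the nodes of L and R, so the contributions of these nodes and the \<open>cUp\<close>
  terms cancel. What remains is the number of arcs saved, plus one for each intermediate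
  node.\<close>

lemma hag_value_eq:
  assumes "pair_fin_digraph G" "pair_fin_digraph H"
    and "left_nodes H = Lft ` pverts G" "right_nodes H = Rgt ` pverts G" and "cAgg \<noteq> 0"
  shows "hag_value cAgg cUp G H =
    real (card (parcs G)) + real (card (mid_nodes H)) - real (card (parcs H))"
  using assms
  by (simp add: hag_value_def cost_eq gnn_graph_fin_digraph nodes_gnn_graph card_parcs_gnn_graph
      card_pverts_eq field_simps)

section \<open>The lower bound on the number of arcs of a HAG computation graph\<close>

lemma hag_graph_fin_digraph:
  assumes "pair_fin_digraph G" "hag_graph G H"
  shows "pair_fin_digraph H"
proof -
  have fin: "finite (pverts H)"
    using assms by (simp add: pverts_eq[of H] hag_graph_def pair_fin_digraph.pair_finite_verts)
  have "parcs H \<subseteq> pverts H \<times> pverts H"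
    using assms(2) unfolding hag_graph_def pverts_eq by blast
  with fin show ?thesis
    by unfold_locales (auto intro: finite_subset)
qed

text \<open>A reachable node is reachable by a path without repeated nodes, and the HAG condition
  decides for which pairs such a path exists. The later bounds use the path condition only through
  this equivalence.\<close>

lemma hag_graph_reachable_iff:
  assumes "pair_fin_digraph G" "hag_graph G H" "u \<in> pverts G" "v \<in> pverts G"
  shows "Lft u \<rightarrow>\<^sup>*\<^bsub>with_proj H\<^esub> Rgt v \<longleftrightarrow> (u, v) \<in> parcs G"
proof -
  interpret H: pair_fin_digraph H using assms hag_graph_fin_digraph by blast
  show ?thesis
    using assms unfolding H.reachable_apath hag_graph_def by (metis (full_types))
qed

lemma hag_graph_left_no_in:
  assumes "hag_graph G H" shows "(x, Lft u) \<notin> parcs H"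
  using assms by (auto simp: hag_graph_def mid_nodes_def right_nodes_def)

lemma (in pair_wf_digraph) reachable_last_arc:
  assumes "u \<rightarrow>\<^sup>*\<^bsub>with_proj G\<^esub> v" "u \<noteq> v"
  obtains x where "u \<rightarrow>\<^sup>*\<^bsub>with_proj G\<^esub> x" "(x, v) \<in> parcs G"
  using assms by (induction rule: reachable_induct) auto

text \<open>The in-neighbourhood of \<open>v\<close> in \<open>G\<close> is the union of the covers
  of the nodes feeding \<open>Rgt v\<close>. With a single feeding node, the cover of that node is
  the whole in-neighbourhood.\<close>

lemma hag_in_degree_right:
  assumes G: "pair_fin_digraph G" and hag: "hag_graph G H"
    and v: "v \<in> pverts G" and two: "2 \<le> card {u. (u, v) \<in> parcs G}"
  shows "2 \<le> in_degree (with_proj H) (Rgt v) \<or>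
    (in_degree (with_proj H) (Rgt v) = 1 \<and>
     (\<exists>m \<in> mid_nodes H. {u. (u, v) \<in> parcs G} = {u. Lft u \<in> cover H m}))"
proof -
  interpret G: pair_fin_digraph G by fact
  interpret H: pair_fin_digraph H using G hag by (rule hag_graph_fin_digraph)
  let ?X = "{x. (x, Rgt v) \<in> parcs H}"
  have L: "left_nodes H = Lft ` pverts G" using hag by (simp add: hag_graph_def)
  have "in_arcs (with_proj H) (Rgt v) = (\<lambda>x. (x, Rgt v)) ` ?X" by auto
  then have deg: "in_degree (with_proj H) (Rgt v) = card ?X"
    by (simp add: in_degree_def card_image inj_on_def)
  have "?X \<subseteq> pverts H" using H.in_arcsD1 by blast
  then have fin: "finite ?X" using H.pair_finite_verts finite_subset by blast
  \<comment> \<open>Since \<open>Lft u\<close> and \<open>Rgt v\<close> differ, a walk between them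
    has a last arc, and its source lies in \<open>?X\<close>. Conversely, a walk to a member of
    \<open>?X\<close> extends by one arc.\<close>
  have nbr: "(u, v) \<in> parcs G \<longleftrightarrow> u \<in> pverts G \<and> (\<exists>x\<in>?X. Lft u \<rightarrow>\<^sup>*\<^bsub>with_proj H\<^esub> x)" for u
    using hag_graph_reachable_iff[OF G hag _ v, of u] G.in_arcsD1[of u v]
    by (auto elim: H.reachable_last_arc intro: H.reachable_adj_trans)
  have "?X \<noteq> {}" using two nbr by force
  then have "card ?X \<noteq> 0" using fin by simp
  then consider "2 \<le> card ?X" | "card ?X = 1" by linarith
  then show ?thesis
  proof cases
    case 2
    then obtain x where X: "?X = {x}" by (auto simp: card_1_singleton_iff)
    have x: "{u. (u, v) \<in> parcs G} = {u. Lft u \<in> cover H x}"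
      using nbr by (auto simp: X cover_def L)
    \<comment> \<open>No arc enters a left-hand node, so the cover of \<open>Lft w\<close> contains
      at most \<open>Lft w\<close> itself, which is too small for an in-neighbourhood of size at
      least 2.\<close>
    have "x \<noteq> Lft w" for w
    proof
      assume w: "x = Lft w"
      have "{u. (u, v) \<in> parcs G} \<subseteq> {w}"
        unfolding x using hag_graph_left_no_in[OF hag]
        by (auto simp: w cover_def elim: H.reachable_last_arc)
      from card_mono[OF _ this] two show False by simp
    qed
    moreover have "x \<in> left_nodes H \<union> mid_nodes H"
      using hag X unfolding hag_graph_def by blast
    ultimately have "x \<in> mid_nodes H" by (auto simp: left_nodes_def)
    with 2 x deg show ?thesis by auto
  qed (simp add: deg)
qed

text \<open>The term \<open>card (mid_nodes H)\<close> here is the one that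
  \<open>hag_value_eq\<close> adds, so the two cancel and the resulting bound on the value does not
  depend on how many intermediate nodes are used.\<close>

lemma card_parcs_d_hag_ge:
  assumes G: "pair_fin_digraph G" and d_hag: "d_hag_graph 2 G H"
    and two: "\<And>v. v \<in> pverts G \<Longrightarrow> 2 \<le> card {u. (u, v) \<in> parcs G}"
    and inj: "inj_on (\<lambda>v. {u. (u, v) \<in> parcs G}) (pverts G)"
  shows "2 * card (pverts G) + card (mid_nodes H) \<le> card (parcs H)"
proof -
  have hag: "hag_graph G H" and mid: "m \<in> mid_nodes H \<Longrightarrow> in_degree (with_proj H) m = 2" for m
    using d_hag by (auto simp: d_hag_graph_def)
  interpret G: pair_fin_digraph G by fact
  interpret H: pair_fin_digraph H using G hag by (rule hag_graph_fin_digraph)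
  note finG = G.pair_finite_verts and finH = H.pair_finite_verts
  let ?d = "in_degree (with_proj H)"
  \<comment> \<open>\<open>F\<close> indexes the right-hand nodes that fall one arc short of
    in-degree 2. An injection of \<open>F\<close> into the intermediate nodes limits this
    shortfall.\<close>
  define F where "F = {v \<in> pverts G. ?d (Rgt v) = 1}"
  have finM: "finite (mid_nodes H)" and R: "right_nodes H = Rgt ` pverts G"
    using hag by (auto simp: hag_graph_def)
  have "\<forall>v\<in>F. \<exists>m\<in>mid_nodes H. {u. (u, v) \<in> parcs G} = {u. Lft u \<in> cover H m}"
    using hag_in_degree_right[OF G hag _ two] by (fastforce simp: F_def)
  then obtain f where f: "\<And>v. v \<in> F \<Longrightarrow> f v \<in> mid_nodes H"
      "\<And>v. v \<in> F \<Longrightarrow> {u. (u, v) \<in> parcs G} = {u. Lft u \<in> cover H (f v)}"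
    by metis
  \<comment> \<open>Equal images have the same cover, hence come from vertices with the same
    in-neighbourhood in \<open>G\<close>, and \<open>inj\<close> separates these.\<close>
  have "inj_on f F"
  proof (rule inj_onI)
    fix v w assume vw: "v \<in> F" "w \<in> F" "f v = f w"
    then have "{u. (u, v) \<in> parcs G} = {u. (u, w) \<in> parcs G}" using f(2) by simp
    with vw show "v = w" using inj by (auto simp: F_def inj_on_def)
  qed
  then have F: "card F \<le> card (mid_nodes H)"
    using f(1) finM by (intro card_inj_on_le[of f]) auto
  have "2 * card (pverts G) = (\<Sum>v\<in>pverts G. 2)" by simp
  \<comment> \<open>The extra 1 for members of \<open>F\<close> makes up for their missing arc, so
    every summand is at least 2.\<close>
  also have "\<dots> \<le> (\<Sum>v\<in>pverts G. ?d (Rgt v) + (if v \<in> F then 1 else 0))"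
    using hag_in_degree_right[OF G hag _ two] by (intro sum_mono) (fastforce simp: F_def)
  also have "\<dots> = (\<Sum>w\<in>right_nodes H. ?d w) + card F"
    using finG by (simp add: R sum.distrib sum.reindex inj_on_def sum.If_cases F_def Int_def)
  finally have "2 * card (pverts G) \<le> (\<Sum>w\<in>right_nodes H. ?d w) + card (mid_nodes H)"
    using F by linarith
  moreover have "2 * card (mid_nodes H) = (\<Sum>w\<in>mid_nodes H. ?d w)"
    using mid by simp
  moreover have "(\<Sum>w\<in>mid_nodes H \<union> right_nodes H. ?d w)
      = (\<Sum>w\<in>mid_nodes H. ?d w) + (\<Sum>w\<in>right_nodes H. ?d w)"
    using finG finM by (intro sum.union_disjoint) (auto simp: R mid_nodes_def)
  moreover have "(\<Sum>w\<in>mid_nodes H \<union> right_nodes H. ?d w) \<le> (\<Sum>w\<in>pverts H. ?d w)"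
    using finH by (intro sum_mono2) (auto simp: pverts_eq)
  ultimately show ?thesis
    using sum_in_degree[of H] H.pair_fin_digraph_axioms by simp
qed

section \<open>The instance and its optimal solution\<close>

definition bad_graph :: "nat pair_pre_digraph" where
  "bad_graph = \<lparr> pverts = {0, 1, 2, 3},
     parcs = {(0, 0), (1, 0), (2, 0), (1, 1), (2, 1), (3, 1), (0, 2), (1, 2), (2, 3), (3, 3)} \<rparr>"

text \<open>\<open>Mid 1\<close> aggregates 0 and 1 for the right-hand nodes 0 and 2, and
  \<open>Mid 2\<close> aggregates 2 and 3 for 1 and 3. Each replaces four direct arcs by four arcs
  through a new node, a gain of 1.\<close>

definition bad_opt :: "nat cgraph" where
  "bad_opt = \<lparr> pverts = Lft ` {0, 1, 2, 3} \<union> Mid ` {1, 2} \<union> Rgt ` {0, 1, 2, 3},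
     parcs = {(Lft 0, Mid 1), (Lft 1, Mid 1), (Lft 2, Mid 2), (Lft 3, Mid 2),
       (Mid 1, Rgt 0), (Lft 2, Rgt 0), (Lft 1, Rgt 1), (Mid 2, Rgt 1),
       (Mid 1, Rgt 2), (Mid 2, Rgt 3)} \<rparr>"

lemma bad_graph_fin_digraph: "pair_fin_digraph bad_graph"
  by unfold_locales (auto simp: bad_graph_def)

lemma card_parcs_bad_graph: "card (parcs bad_graph) = 10"
  by (simp add: bad_graph_def)

lemma bad_graph_d_hag_value_le:
  assumes "d_hag_graph 2 bad_graph H" "cAgg \<noteq> 0"
  shows "hag_value cAgg cUp bad_graph H \<le> 2"
proof -
  have nbrs: "{u. (u, 0) \<in> parcs bad_graph} = {0, 1, 2}"
    "{u. (u, Suc 0) \<in> parcs bad_graph} = {1, 2, 3}"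
    "{u. (u, 2) \<in> parcs bad_graph} = {0, 1}"
    "{u. (u, 3) \<in> parcs bad_graph} = {2, 3}"
    by (auto simp: bad_graph_def)
  have V: "pverts bad_graph = {0, 1, 2, 3}" "card (pverts bad_graph) = 4"
    by (simp_all add: bad_graph_def)
  have "inj_on (\<lambda>v. {u. (u, v) \<in> parcs bad_graph}) (pverts bad_graph)"
    unfolding V by (simp add: inj_on_def nbrs set_eq_subset) (simp add: bad_graph_def)
  moreover have "2 \<le> card {u. (u, v) \<in> parcs bad_graph}" if "v \<in> pverts bad_graph" for v
    using that by (auto simp: V nbrs)
  \<comment> \<open>With the 10 arcs of \<open>bad_graph\<close>, the value is at most 10 - 8 =
    2.\<close>
  ultimately have "2 * 4 + card (mid_nodes H) \<le> card (parcs H)"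
    using card_parcs_d_hag_ge[OF bad_graph_fin_digraph assms(1)] by (simp add: V)
  moreover have "hag_graph bad_graph H" using assms(1) by (simp add: d_hag_graph_def)
  ultimately show ?thesis
    using hag_graph_fin_digraph[OF bad_graph_fin_digraph, of H] assms(2)
      hag_value_eq[OF bad_graph_fin_digraph, of H cAgg cUp] card_parcs_bad_graph
    by (auto simp: hag_graph_def)
qed

lemma bad_opt_fin_digraph: "pair_fin_digraph bad_opt"
  by unfold_locales (auto simp: bad_opt_def)

lemma nodes_bad_opt:
  "left_nodes bad_opt = Lft ` {0, 1, 2, 3}"
  "mid_nodes bad_opt = Mid ` {1, 2}"
  "right_nodes bad_opt = Rgt ` {0, 1, 2, 3}"
  by (auto simp: bad_opt_def left_nodes_def mid_nodes_def right_nodes_def)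

lemma bad_opt_arcs_into:
  "(x, Lft u) \<notin> parcs bad_opt"
  "(x, Mid (Suc 0)) \<in> parcs bad_opt \<longleftrightarrow> x = Lft 0 \<or> x = Lft 1"
  "(x, Mid 2) \<in> parcs bad_opt \<longleftrightarrow> x = Lft 2 \<or> x = Lft 3"
  by (auto simp: bad_opt_def)

text \<open>Right-hand nodes are sinks and no arc joins two intermediate nodes, so a walk from left
  to right has one or two arcs. Listing these walks turns existence and uniqueness of paths into a
  finite check.\<close>

lemma bad_opt_apath_iff:
  "pre_digraph.apath (with_proj bad_opt) (Lft u) p (Rgt v) \<longleftrightarrow>
    p = [(Lft u, Rgt v)] \<and> (Lft u, Rgt v) \<in> parcs bad_opt \<or>
    (\<exists>m \<in> {1, 2}. p = [(Lft u, Mid m), (Mid m, Rgt v)] \<and>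
      (Lft u, Mid m) \<in> parcs bad_opt \<and> (Mid m, Rgt v) \<in> parcs bad_opt)"
    (is "?l = ?r")
proof -
  interpret pair_fin_digraph bad_opt by (rule bad_opt_fin_digraph)
  have L: "(Lft a, y) \<in> parcs bad_opt \<Longrightarrow> y \<in> Mid ` {1, 2} \<union> range Rgt"
    and M: "(Mid b, y) \<in> parcs bad_opt \<Longrightarrow> y \<in> range Rgt"
    and R: "(Rgt c, y) \<notin> parcs bad_opt" for a b c y
    by (auto simp: bad_opt_def)
  have R': "awalk (Rgt c) q y \<longleftrightarrow> q = [] \<and> y = Rgt c \<and> y \<in> pverts bad_opt" for c q y
    using R by (cases q) (auto simp: awalk_simps)
  have M': "awalk (Mid b) q (Rgt v) \<longleftrightarrow> q = [(Mid b, Rgt v)] \<and> (Mid b, Rgt v) \<in> parcs bad_opt" for b q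
  proof (cases q)
    case (Cons e q')
    show ?thesis
    proof
      assume "awalk (Mid b) q (Rgt v)"
      then have e: "(Mid b, snd e) \<in> parcs bad_opt" "fst e = Mid b" and q': "awalk (snd e) q' (Rgt v)"
        by (cases e; simp add: Cons awalk_simps)+
      from M[OF e(1)] obtain c where "snd e = Rgt c" by auto
      with e q' show "q = [(Mid b, Rgt v)] \<and> (Mid b, Rgt v) \<in> parcs bad_opt"
        by (cases e) (simp add: Cons R')
    next
      assume "q = [(Mid b, Rgt v)] \<and> (Mid b, Rgt v) \<in> parcs bad_opt"
      then show "awalk (Mid b) q (Rgt v)" by (auto simp: awalk_simps dest: in_arcsD1 in_arcsD2)
    qed
  qed (simp add: awalk_simps)
  have "awalk (Lft u) p (Rgt v) \<longleftrightarrow> ?r"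
  proof (cases p)
    case (Cons e q)
    show ?thesis
    proof
      assume "awalk (Lft u) p (Rgt v)"
      then have e: "(Lft u, snd e) \<in> parcs bad_opt" "fst e = Lft u" and q: "awalk (snd e) q (Rgt v)"
        by (cases e; simp add: Cons awalk_simps)+
      from L[OF e(1)] consider m where "snd e = Mid m" "m \<in> {1, 2}" | c where "snd e = Rgt c" by auto
      then show ?r
        using e q by cases (cases e; simp add: Cons R' M')+
    next
      assume ?r
      then show "awalk (Lft u) p (Rgt v)" by (auto simp: awalk_simps M' dest: in_arcsD1 in_arcsD2)
    qed
  qed (simp add: awalk_simps)
  then show ?thesis by (auto simp: apath_def)
qed

lemma bad_opt_hag: "d_hag_graph 2 bad_graph bad_opt"
proof -
  interpret pair_fin_digraph bad_opt by (rule bad_opt_fin_digraph)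
  \<comment> \<open>Every arc increases this layer number, which gives acyclicity.\<close>
  let ?r = "case_node (\<lambda>_. 0) (\<lambda>_. 1) (\<lambda>_. 2 :: nat)"
  have "parcs bad_opt \<subseteq> measure ?r" by (auto simp: bad_opt_def)
  then have ac: "acyclic (parcs bad_opt)" by (meson acyclic_subset wf_acyclic wf_measure)
  have paths: "\<forall>u \<in> pverts bad_graph. \<forall>v \<in> pverts bad_graph.
        if (u, v) \<in> parcs bad_graph
        then \<exists>!p. pre_digraph.apath (with_proj bad_opt) (Lft u) p (Rgt v)
        else \<not> (\<exists>p. pre_digraph.apath (with_proj bad_opt) (Lft u) p (Rgt v))"
    unfolding bad_opt_apath_iff by (simp add: bad_graph_def bad_opt_def)
  \<comment> \<open>There are only two intermediate nodes, so one left-hand node that lies in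
    exactly one of their covers proves the covers distinct.\<close>
  have "Lft 0 \<in> cover bad_opt (Mid 1)"
    by (simp add: cover_def nodes_bad_opt bad_opt_arcs_into reachable_adjI)
  moreover have "Lft 0 \<notin> cover bad_opt (Mid 2)"
  proof
    assume "Lft 0 \<in> cover bad_opt (Mid 2)"
    then have "Lft 0 \<rightarrow>\<^sup>*\<^bsub>with_proj bad_opt\<^esub> Mid 2" by (simp add: cover_def)
    then obtain x where x: "Lft 0 \<rightarrow>\<^sup>*\<^bsub>with_proj bad_opt\<^esub> x" "x = Lft 2 \<or> x = Lft 3"
      by (rule reachable_last_arc) (simp_all add: bad_opt_arcs_into)
    then have "Lft 0 \<noteq> x" by auto
    from reachable_last_arc[OF x(1) this] x(2) show False
      by (metis bad_opt_arcs_into(1))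
  qed
  ultimately have "inj_on (cover bad_opt) (mid_nodes bad_opt)"
    unfolding nodes_bad_opt inj_on_def by (simp add: ball_simps) metis
  moreover have "parcs bad_opt \<subseteq> left_nodes bad_opt \<times> mid_nodes bad_opt
      \<union> mid_nodes bad_opt \<times> right_nodes bad_opt \<union> mid_nodes bad_opt \<times> mid_nodes bad_opt
      \<union> left_nodes bad_opt \<times> right_nodes bad_opt"
    unfolding nodes_bad_opt by (simp add: bad_opt_def)
  moreover have "left_nodes bad_opt = Lft ` pverts bad_graph" "right_nodes bad_opt = Rgt ` pverts bad_graph"
    "finite (mid_nodes bad_opt)"
    unfolding nodes_bad_opt by (simp_all add: bad_graph_def)
  ultimately have "hag_graph bad_graph bad_opt"
    using ac paths unfolding hag_graph_def by blast
  moreover have "in_arcs (with_proj bad_opt) (Mid (Suc 0)) = {(Lft 0, Mid 1), (Lft 1, Mid 1)}"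
    "in_arcs (with_proj bad_opt) (Mid 2) = {(Lft 2, Mid 2), (Lft 3, Mid 2)}"
    by (auto simp: bad_opt_arcs_into)
  ultimately show ?thesis
    by (simp add: d_hag_graph_def nodes_bad_opt in_degree_def)
qed

lemma bad_opt_value:
  assumes "cAgg \<noteq> 0"
  shows "hag_value cAgg cUp bad_graph bad_opt = 2"
proof -
  have "left_nodes bad_opt = Lft ` pverts bad_graph" "right_nodes bad_opt = Rgt ` pverts bad_graph"
    unfolding nodes_bad_opt by (simp_all add: bad_graph_def)
  moreover have "card (mid_nodes bad_opt) = 2" by (simp add: nodes_bad_opt)
  moreover have "card (parcs bad_opt) = 10" by (simp add: bad_opt_def)
  ultimately show ?thesis
    using hag_value_eq[OF bad_graph_fin_digraph bad_opt_fin_digraph] assms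
    by (simp add: card_parcs_bad_graph)
qed

section \<open>An execution of FullGreedy with value 1\<close>

definition run_graph :: "nat set \<Rightarrow> (nat node \<times> nat node) set \<Rightarrow> nat cgraph" where
  "run_graph M A = \<lparr> pverts = Lft ` {0, 1, 2, 3} \<union> Mid ` M \<union> Rgt ` {0, 1, 2, 3}, parcs = A \<rparr>"

lemma nodes_run_graph:
  "left_nodes (run_graph M A) = Lft ` {0, 1, 2, 3}"
  "mid_nodes (run_graph M A) = Mid ` M"
  "right_nodes (run_graph M A) = Rgt ` {0, 1, 2, 3}"
  by (auto simp: run_graph_def left_nodes_def mid_nodes_def right_nodes_def)

lemma common_right_run_graph:
  "common_right (run_graph M A) C =
    (if \<forall>v\<in>C. (v, Rgt 0) \<in> A then {Rgt 0} else {}) \<union>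
    (if \<forall>v\<in>C. (v, Rgt 1) \<in> A then {Rgt 1} else {}) \<union>
    (if \<forall>v\<in>C. (v, Rgt 2) \<in> A then {Rgt 2} else {}) \<union>
    (if \<forall>v\<in>C. (v, Rgt 3) \<in> A then {Rgt 3} else {})"
  unfolding common_right_def nodes_run_graph by (auto simp: out_nbrs_def run_graph_def)

text \<open>Sets of size 2 are pairs of distinct nodes, so maximality becomes a check over finitely
  many pairs. The equations for \<open>R\<close> and \<open>B\<close> let each iteration be stated
  with explicit arc sets.\<close>

lemma run_graph_step:
  assumes run: "full_greedy_run 2 G i (run_graph M A)"
    and C: "C \<subseteq> Lft ` {0, 1, 2, 3} \<union> Mid ` M" "card C = 2"
    and R: "common_right (run_graph M A) C = R"
    and max: "\<forall>x \<in> Lft ` {0, 1, 2, 3} \<union> Mid ` M. \<forall>y \<in> Lft ` {0, 1, 2, 3} \<union> Mid ` M. x \<noteq> y \<longrightarrow>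
      card (common_right (run_graph M A) {x, y}) \<le> card R"
    and j: "j = Suc i"
    and B: "A \<union> C \<times> {Mid j} \<union> {Mid j} \<times> R - C \<times> R = B"
  shows "full_greedy_run 2 G j (run_graph (insert j M) B)"
proof -
  have "is_arg_max (\<lambda>C. card (common_right (run_graph M A) C))
    (\<lambda>C. C \<subseteq> left_nodes (run_graph M A) \<union> mid_nodes (run_graph M A) \<and> card C = 2) C"
    unfolding is_arg_max_linorder nodes_run_graph
  proof (intro conjI allI impI C)
    fix D :: "nat node set"
    assume D: "D \<subseteq> Lft ` {0, 1, 2, 3} \<union> Mid ` M \<and> card D = 2"
    then obtain x y where xy: "D = {x, y}" "x \<noteq> y" by (meson card_2_iff)
    with D have "x \<in> Lft ` {0, 1, 2, 3} \<union> Mid ` M" "y \<in> Lft ` {0, 1, 2, 3} \<union> Mid ` M"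
      by blast+
    from mp[OF bspec[OF bspec[OF max this(1)] this(2)] xy(2)]
    show "card (common_right (run_graph M A) D) \<le> card (common_right (run_graph M A) C)"
      unfolding R xy(1) .
  qed
  note full_greedy_run.step[OF run this]
  moreover have "add_aggregation (run_graph M A) C (Mid (Suc i)) = run_graph (insert j M) B"
    unfolding add_aggregation_def Let_def R B[symmetric] j
    by (simp add: run_graph_def insert_commute)
  ultimately show ?thesis
    unfolding j by simp
qed

lemma bad_graph_greedy_run:
  obtains H where "full_greedy_run 2 bad_graph 3 H"
    "\<And>cAgg cUp. cAgg \<noteq> 0 \<Longrightarrow> hag_value cAgg cUp bad_graph H = 1"
proof -
  \<comment> \<open>The arc sets after 0, 1, 2 and 3 iterations, with 10, 10, 11 and 12
    arcs.\<close>
  let ?A0 = "{(Lft 0, Rgt 0), (Lft 1, Rgt 0), (Lft 2, Rgt 0), (Lft 1, Rgt 1), (Lft 2, Rgt 1),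
    (Lft 3, Rgt 1), (Lft 0, Rgt 2), (Lft 1, Rgt 2), (Lft 2, Rgt 3), (Lft 3, Rgt 3)} :: nat node rel"
  let ?A1 = "{(Lft 1, Mid 1), (Lft 2, Mid 1), (Lft 0, Rgt 0), (Mid 1, Rgt 0), (Mid 1, Rgt 1),
    (Lft 3, Rgt 1), (Lft 0, Rgt 2), (Lft 1, Rgt 2), (Lft 2, Rgt 3), (Lft 3, Rgt 3)} :: nat node rel"
  let ?A2 = "{(Lft 1, Mid 1), (Lft 2, Mid 1), (Lft 0, Mid 2), (Mid 1, Mid 2), (Mid 2, Rgt 0),
    (Mid 1, Rgt 1), (Lft 3, Rgt 1),
    (Lft 0, Rgt 2), (Lft 1, Rgt 2), (Lft 2, Rgt 3), (Lft 3, Rgt 3)} :: nat node rel"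
  let ?A3 = "{(Lft 1, Mid 1), (Lft 2, Mid 1), (Lft 0, Mid 2), (Mid 1, Mid 2), (Mid 2, Rgt 0),
    (Mid 1, Mid 3), (Lft 3, Mid 3), (Mid 3, Rgt 1),
    (Lft 0, Rgt 2), (Lft 1, Rgt 2), (Lft 2, Rgt 3), (Lft 3, Rgt 3)} :: nat node rel"
  have "gnn_graph bad_graph = run_graph {} ?A0"
    by (auto simp: gnn_graph_def bad_graph_def run_graph_def)
  then have 0: "full_greedy_run 2 bad_graph 0 (run_graph {} ?A0)"
    by (metis full_greedy_run.start)
  have 1: "full_greedy_run 2 bad_graph 1 (run_graph {1} ?A1)"
  proof (rule run_graph_step[OF 0])
    \<comment> \<open>This equation also fixes the chosen pair. It ties with
      \<open>{Lft 0, Lft 1}\<close> and \<open>{Lft 2, Lft 3}\<close>, which have two common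
      right-hand successors as well; afterwards no pair has more than one.\<close>
    show "?A0 \<union> {Lft 1, Lft 2} \<times> {Mid 1} \<union> {Mid 1} \<times> {Rgt 0, Rgt 1} - {Lft 1, Lft 2} \<times> {Rgt 0, Rgt 1}
        = ?A1"
      by (intro equalityI) auto
  qed (simp_all add: common_right_run_graph insert_commute)
  have 2: "full_greedy_run 2 bad_graph 2 (run_graph {2, 1} ?A2)"
  proof (rule run_graph_step[OF 1])
    \<comment> \<open>With one common successor, three arcs are added and two removed; the net extra
      arc offsets the new node and the value stays 1. The third iteration behaves in the same
      way.\<close>
    show "?A1 \<union> {Lft 0, Mid 1} \<times> {Mid 2} \<union> {Mid 2} \<times> {Rgt 0} - {Lft 0, Mid 1} \<times> {Rgt 0} = ?A2"
      by (intro equalityI) auto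
  qed (simp_all add: common_right_run_graph insert_commute)
  have 3: "full_greedy_run 2 bad_graph 3 (run_graph {3, 2, 1} ?A3)"
  proof (rule run_graph_step[OF 2])
    show "?A2 \<union> {Lft 3, Mid 1} \<times> {Mid 3} \<union> {Mid 3} \<times> {Rgt 1} - {Lft 3, Mid 1} \<times> {Rgt 1} = ?A3"
      by (intro equalityI) auto
  qed (simp_all add: common_right_run_graph insert_commute)
  have fin: "pair_fin_digraph (run_graph {3, 2, 1} ?A3)"
    by unfold_locales (auto simp: run_graph_def)
  have nodes: "left_nodes (run_graph {3, 2, 1} ?A3) = Lft ` pverts bad_graph"
    "right_nodes (run_graph {3, 2, 1} ?A3) = Rgt ` pverts bad_graph"
    unfolding nodes_run_graph by (simp_all add: bad_graph_def)
  have "card (mid_nodes (run_graph {3, 2, 1} ?A3)) = 3" by (simp add: nodes_run_graph)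
  moreover have "card (parcs (run_graph {3, 2, 1} ?A3)) = 12" by (simp add: run_graph_def)
  ultimately have "hag_value cAgg cUp bad_graph (run_graph {3, 2, 1} ?A3) = 1" if "cAgg \<noteq> 0" for cAgg cUp
    unfolding hag_value_eq[OF bad_graph_fin_digraph fin nodes that] by (simp only: card_parcs_bad_graph)
  with 3 show ?thesis by (rule that)
qed

theorem mainTheorem4:
  fixes cAgg cUp :: real
  assumes "cAgg > 0" and "cUp > 0"
  shows "(\<exists>(G :: nat pair_pre_digraph) Hgreedy.
            pair_fin_digraph G \<and>
            full_greedy_run 2 G 3 Hgreedy \<and>
            hag_value cAgg cUp G Hgreedy = 1 \<and>
            (\<exists>Hopt. optimal_d_hag cAgg cUp 2 G 3 Hopt \<and> hag_value cAgg cUp G Hopt = 2)) \<and>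
         (\<forall>\<alpha> > 1 / 2. \<not> full_greedy_achieves_ratio cAgg cUp 2 \<alpha>)"
proof -
  have nz: "cAgg \<noteq> 0" using assms by simp
  obtain H where H: "full_greedy_run 2 bad_graph 3 H" "hag_value cAgg cUp bad_graph H = 1"
    by (rule bad_graph_greedy_run) (use nz in blast)
  have opt_val: "hag_value cAgg cUp bad_graph bad_opt = 2" using nz by (rule bad_opt_value)
  have opt: "optimal_d_hag cAgg cUp 2 bad_graph 3 bad_opt"
    unfolding optimal_d_hag_def is_arg_max_linorder
    using bad_graph_d_hag_value_le[OF _ nz] by (simp add: opt_val bad_opt_hag nodes_bad_opt)
  have "\<not> full_greedy_achieves_ratio cAgg cUp 2 \<alpha>" if "\<alpha> > 1 / 2" for \<alpha>
  proof
    assume "full_greedy_achieves_ratio cAgg cUp 2 \<alpha>"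
    \<comment> \<open>The claimed ratio is applied to this instance with k = 3, greedy value 1 and
      optimal value 2.\<close>
    then have "\<alpha> * 2 \<le> 1"
      using bad_graph_fin_digraph H opt opt_val unfolding full_greedy_achieves_ratio_def by metis
    with that show False by simp
  qed
  with bad_graph_fin_digraph H opt opt_val show ?thesis by blast
qed

end
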